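(* Let $d\ge 1$ be an integer, let $l_1,\dots,l_d\in\mathbb N=\{1,2,\dots\}$ and $n_1,\dots,n_d\in\mathbb N$, and let $f\in C([0,1]^d)$ be real-valued. Then for every $(x_1,\dots,x_d)\in[0,1]^d$, $$\left|\left(B_{l_1}^{n_1}\otimes\dots\otimes B_{l_d}^{n_d}\right)(f;x_1,\dots,x_d)-\left(B_{1}^{n_1}\otimes\dots\otimes B_{1}^{n_d}\right)(f;x_1,\dots,x_d)\right|\le \frac{9}{4}\sum_{\delta=1}^{d}\omega_2\Bigl(f;0,\dots,0,\sqrt{x_\delta(1-x_\delta)\bigl(1-\tfrac{1}{l_\delta}\bigr)^{n_\delta}},0,\dots,0\Bigr),$$ where in the $\delta$-th summand the possibly nonzero argument of $\omega_2(f;\cdot)$ stands in the $\delta$-th position.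
   Context: For an integer $n\ge1$ the univariate Bernstein operator is $B_n(g;x)=\sum_{k=0}^n g\left(\frac{k}{n}\right)\binom{n}{k}x^k(1-x)^{n-k}$ for $g:[0,1]\to\mathbb R$ and $x\in[0,1]$. $B_n^k$ denotes the $k$-fold composition (iterate) of $B_n$ with itself. Note that $B_1(g;x)=(1-x)g(0)+xg(1)$, so $B_1^{k}=B_1$ for all $k\ge1$. Tensor products: for a univariate operator $A_\delta$ that is a composition of Bernstein operators, let ${}_{s_\delta}A_\delta$ denote its parametric extension to $C([0,1]^d)$, i.e. $A_\delta$ applied to a $d$-variate function in the $\delta$-th variable $s_\delta$ with all other variables held fixed. Then $A_1\otimes\dots\otimes A_d:={}_{s_1}A_1\circ\dots\circ{}_{s_d}A_d$, and $(A_1\otimes\dots\otimes A_d)(f;x_1,\dots,x_d)$ is the value at $(x_1,\dots,x_d)$ of the resulting function. For instance, $(B_{l_1}\otimes\dots\otimes B_{l_d})(f;x_1,\dots,x_d)=\sum_{i_1=0}^{l_1}\dots\sum_{i_d=0}^{l_d} f\left(\frac{i_1}{l_1},\dots,\frac{i_d}{l_d}\right)\prod_{\delta=1}^d\binom{l_\delta}{i_\delta}x_\delta^{i_\delta}(1-x_\delta)^{l_\delta-i_\delta}$. Partial second order moduli of smoothness: for $f\in C([0,1]^d)$, $h\ge0$ and $1\le\delta\le d$, with $h$ in the $\delta$-th position and $e_\delta$ the $\delta$-th standard unit vector of $\mathbb R^d$, $$\omega_2(f;0,\dots,0,h,0,\dots,0):=\sup\left\{|f(s-\eta e_\delta)-2f(s)+f(s+\eta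 e_\delta)| : s\in[0,1]^d,\ \eta\in\mathbb R,\ |\eta|\le h,\ s\pm\eta e_\delta\in[0,1]^d\right\}.$$ *)

theory Defs
  imports "HOL-Analysis.Analysis"
begin

text \<open>
  The index type \<open>'d :: {finite, linorder}\<close> plays the role of \<open>1 < \<dots> < d\<close> with
  \<open>d = CARD('d) \<ge> 1\<close>; the order only fixes the order of composition in \<open>tensor_op\<close>.
  Functions on \<open>[0,1]\<close> and \<open>[0,1]\<^sup>d\<close> are total functions of which only the values on
  these sets are used.
\<close>

definition unit_cube :: "(real ^ 'd) set" where
  "unit_cube = {x. \<forall>i. x $ i \<in> {0..1}}"

definition bernstein_op :: "nat \<Rightarrow> (real \<Rightarrow> real) \<Rightarrow> real \<Rightarrow> real" where
  "bernstein_op n g x = (\<Sum>k\<le>n. g (real k / real n) * Bernstein n k x)"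

definition parametric_ext ::
    "'d \<Rightarrow> ((real \<Rightarrow> real) \<Rightarrow> real \<Rightarrow> real) \<Rightarrow> (real ^ 'd \<Rightarrow> real) \<Rightarrow> real ^ 'd \<Rightarrow> real" where
  "parametric_ext \<delta> A f x = A (\<lambda>t. f (\<chi> i. if i = \<delta> then t else x $ i)) (x $ \<delta>)"

definition tensor_op ::
    "('d::{finite, linorder} \<Rightarrow> (real \<Rightarrow> real) \<Rightarrow> real \<Rightarrow> real)
      \<Rightarrow> (real ^ 'd::{finite, linorder} \<Rightarrow> real) \<Rightarrow> real ^ 'd::{finite, linorder} \<Rightarrow> real" where
  "tensor_op A = foldr (\<lambda>\<delta> F. parametric_ext \<delta> (A \<delta>) \<circ> F) (sorted_list_of_set UNIV) id"

text \<open>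
  \<open>partial_omega2 f \<delta> h\<close> is \<open>\<omega>\<^sub>2(f; 0, \<dots>, 0, h, 0, \<dots>, 0)\<close> with \<open>h\<close> in position \<open>\<delta>\<close>.
  As a real supremum it is meaningful for \<open>h \<ge> 0\<close> and \<open>f\<close> bounded on the cube.
\<close>

definition partial_omega2 :: "(real ^ 'd \<Rightarrow> real) \<Rightarrow> 'd \<Rightarrow> real \<Rightarrow> real" where
  "partial_omega2 f \<delta> h =
     Sup {\<bar>f (s - \<eta> *\<^sub>R axis \<delta> 1) - 2 * f s + f (s + \<eta> *\<^sub>R axis \<delta> 1)\<bar> | s \<eta>.
       s \<in> unit_cube \<and> \<bar>\<eta>\<bar> \<le> h \<and>
       s - \<eta> *\<^sub>R axis \<delta> 1 \<in> unit_cube \<and> s + \<eta> *\<^sub>R axis \<delta> 1 \<in> unit_cube}"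

end

theory Submission
  imports Defs
begin

text \<open>
  In one variable let \<open>L = B\<^sub>l\<^sup>n\<close> and \<open>h\<^sup>2 = x (1 - x) (1 - 1/l)\<^sup>n\<close>. Since \<open>L\<close> is positive and
  reproduces affine functions, \<open>L g \<le> B\<^sub>1 g\<close> for convex \<open>g\<close>, while \<open>B\<^sub>1 e\<^sub>2 - L e\<^sub>2 = h\<^sup>2\<close> at \<open>x\<close>. Hence
  \<open>\<bar>L \<phi> - B\<^sub>1 \<phi>\<bar> \<le> K h\<^sup>2\<close> at \<open>x\<close> whenever \<open>K e\<^sub>2 \<plusminus> \<phi>\<close> are convex. Zhuk's smoothing of \<open>g\<close>, the double
  Steklov average with step \<open>h\<close> of an extension of \<open>g\<close>, has distance at most \<open>3/4 \<omega>\<^sub>2(g; h)\<close> from \<open>g\<close>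
  and second derivative at most \<open>3/2 \<omega>\<^sub>2(g; h) / h\<^sup>2\<close>, so that \<open>2 \<cdot> 3/4 + 3/4 = 9/4\<close> is the constant.
  Several variables follow by exchanging the operators one coordinate at a time.
\<close>

section \<open>Near-best affine approximation from second differences\<close>

text \<open>Take \<open>p < q < r\<close> at which the deviation \<open>D\<close> of \<open>g\<close> from a chord over \<open>[a,b]\<close> is maximal.
  Maximality forces \<open>g\<close> to stay within \<open>D\<close> of the chord's line, on one side of it, on all of \<open>[a,b]\<close>;
  the second difference at \<open>q\<close> with one node at the nearer of \<open>p\<close>, \<open>r\<close> gives \<open>D \<le> W\<close>.\<close>

lemma second_difference_best_affine:
  fixes g :: "real \<Rightarrow> real"
  assumes "a < b" and cont: "continuous_on {a..b} g"
    and W: "\<And>s \<eta>. \<lbrakk>0 \<le> \<eta>; \<eta> \<le> (b - a) / 2; a \<le> s - \<eta>; s + \<eta> \<le> b\<rbrakk>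
      \<Longrightarrow> \<bar>g (s - \<eta>) - 2 * g s + g (s + \<eta>)\<bar> \<le> W"
  shows "\<exists>c m. \<forall>t\<in>{a..b}. \<bar>g t - (c + m * t)\<bar> \<le> W / 2"
proof -
  \<comment> \<open>The signed height of the chord over \<open>p\<close>, \<open>r\<close> above the
    graph of \<open>g\<close> at parameter \<open>s\<close>. Using \<open>s\<close> instead of the
    point itself makes the domain compact, with value 0 on the degenerate triples
    \<open>p = r\<close>, so a maximum is attained.\<close>
  define dev where
    "dev g z = (case z of (p, r, s) \<Rightarrow> (1 - s) * g p + s * g r - g ((1 - s) * p + s * r))"
    for g :: "real \<Rightarrow> real" and z :: "real \<times> real \<times> real"
  \<comment> \<open>The normalised situation: the extremal chord has \<open>p < r\<close> and lies
    above the graph. The opposite sign is reduced to it at the end by passing to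
    \<open>-g\<close>.\<close>
  have main: "\<exists>c m. \<forall>t\<in>{a..b}. \<bar>g t - (c + m * t)\<bar> \<le> W / 2"
    if cont: "continuous_on {a..b} g"
      and W: "\<And>s \<eta>. \<lbrakk>0 \<le> \<eta>; \<eta> \<le> (b - a) / 2; a \<le> s - \<eta>; s + \<eta> \<le> b\<rbrakk>
        \<Longrightarrow> \<bar>g (s - \<eta>) - 2 * g s + g (s + \<eta>)\<bar> \<le> W"
      and prs: "p \<in> {a..b}" "r \<in> {a..b}" "s \<in> {0..1}" "p < r"
      and max: "\<And>z. z \<in> {a..b} \<times> {a..b} \<times> {0..1} \<Longrightarrow> \<bar>dev g z\<bar> \<le> dev g (p, r, s)"
    for g :: "real \<Rightarrow> real" and p r s
  proof -
    define D where "D = dev g (p, r, s)"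
    define m where "m = (g r - g p) / (r - p)"
    define c where "c = g p - m * p"
    define u where "u t = g t - (c + m * t)" for t
    define q where "q = (1 - s) * p + s * r"
    have up: "u p = 0" by (simp add: u_def c_def)
    have "m * (r - p) = g r - g p" using \<open>p < r\<close> by (simp add: m_def)
    then have ur: "u r = 0" by (simp add: u_def c_def algebra_simps)
    have gu: "g t = u t + (c + m * t)" for t by (simp add: u_def)
    have uq: "u q = - D"
      using up ur unfolding D_def dev_def q_def gu by (simp add: algebra_simps)
    have D0: "0 \<le> D" using max[of "(p, r, s)"] prs by (simp add: D_def)
    have "p \<le> q" "q \<le> r"
    proof -
      have "q = p + s * (r - p)" "q = r - (1 - s) * (r - p)" by (auto simp: q_def algebra_simps)
      moreover have "0 \<le> s * (r - p)" "0 \<le> (1 - s) * (r - p)" using prs by auto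
      ultimately show "p \<le> q" "q \<le> r" by linarith+
    qed
    \<comment> \<open>Maximality of \<open>D\<close>, multiplied by \<open>z - x\<close>.
      Subtracting an affine function does not change \<open>dev\<close>, so \<open>u\<close> may
      replace \<open>g\<close>.\<close>
    have H: "\<bar>(z - y) * u x + (y - x) * u z - (z - x) * u y\<bar> \<le> D * (z - x)"
      if "a \<le> x" "x \<le> y" "y \<le> z" "z \<le> b" "x < z" for x y z
    proof -
      define \<sigma> where "\<sigma> = (y - x) / (z - x)"
      have s: "\<sigma> * (z - x) = y - x" using that by (simp add: \<sigma>_def)
      have "0 \<le> \<sigma>" "\<sigma> \<le> 1" using that by (auto simp: \<sigma>_def)
      then have le: "\<bar>dev g (x, z, \<sigma>)\<bar> \<le> D"
        unfolding D_def using that by (intro max) auto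
      have y: "(1 - \<sigma>) * x + \<sigma> * z = y" using s by (simp add: algebra_simps)
      have "dev g (x, z, \<sigma>) = (1 - \<sigma>) * u x + \<sigma> * u z - u y"
        unfolding dev_def using y by (simp add: gu algebra_simps flip: y)
      then have "dev g (x, z, \<sigma>) * (z - x)
          = ((z - x) - \<sigma> * (z - x)) * u x + (\<sigma> * (z - x)) * u z - (z - x) * u y"
        by (simp only:) (simp add: algebra_simps)
      also have "\<dots> = (z - y) * u x + (y - x) * u z - (z - x) * u y"
        unfolding s by simp
      finally have eq: "dev g (x, z, \<sigma>) * (z - x)
          = (z - y) * u x + (y - x) * u z - (z - x) * u y" .
      have "\<bar>(z - y) * u x + (y - x) * u z - (z - x) * u y\<bar>
          = \<bar>dev g (x, z, \<sigma>)\<bar> * (z - x)"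
        using that by (simp only: abs_mult flip: eq)
      then show ?thesis
        using mult_right_mono[OF le, of "z - x"] that by simp
    qed
    have "D \<le> W \<and> (\<forall>t\<in>{a..b}. -D \<le> u t \<and> u t \<le> 0)" if "0 < D"
    proof -
      have "p \<noteq> q" "q \<noteq> r" using up ur uq that by auto
      with \<open>p \<le> q\<close> \<open>q \<le> r\<close> have pqr: "p < q" "q < r" by auto
      \<comment> \<open>If \<open>u t\<close> were positive, the chord from \<open>t\<close> to
        \<open>r\<close> or from \<open>p\<close> to \<open>t\<close> would pass more than
        \<open>D\<close> above the graph at \<open>q\<close>. If it were below \<open>-D\<close>,
        some chord would deviate by more than \<open>D\<close>: at \<open>p\<close> the one from
        \<open>t\<close> to \<open>q\<close>, at \<open>t\<close> the one from \<open>p\<close> to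
        \<open>r\<close>, or at \<open>r\<close> the one from \<open>q\<close> to
        \<open>t\<close>.\<close>
      have bounds: "-D \<le> u t \<and> u t \<le> 0" if t: "t \<in> {a..b}" for t
      proof
        show "u t \<le> 0"
        proof (cases "t < q")
          case True
          then have "(r - q) * u t \<le> 0"
            using H[of t q r] t prs pqr up ur uq by (simp add: algebra_simps)
          then show ?thesis using pqr by (simp add: mult_le_0_iff)
        next
          case False
          then have "(q - p) * u t \<le> 0"
            using H[of p q t] t prs pqr up ur uq by (simp add: algebra_simps)
          then show ?thesis using pqr by (simp add: mult_le_0_iff)
        qed
        consider "t < p" | "p \<le> t" "t \<le> r" | "r < t" by linarith
        then show "-D \<le> u t"
        proof cases
          case 1
          then have "0 \<le> (q - p) * (u t + D)"
            using H[of t p q] t prs pqr up ur uq by (simp add: algebra_simps)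
          then show ?thesis using pqr by (simp add: zero_le_mult_iff)
        next
          case 2
          then have "0 \<le> (r - p) * (u t + D)"
            using H[of p t r] t prs pqr up ur uq by (simp add: algebra_simps abs_le_iff)
          then show ?thesis using pqr by (simp add: zero_le_mult_iff)
        next
          case 3
          then have "0 \<le> (r - q) * (u t + D)"
            using H[of q r t] t prs pqr up ur uq by (simp add: algebra_simps)
          then show ?thesis using pqr by (simp add: zero_le_mult_iff)
        qed
      qed
      have Wu: "u (y - \<eta>) - 2 * u y + u (y + \<eta>) \<le> W"
        if "0 \<le> \<eta>" "\<eta> \<le> (b - a) / 2" "a \<le> y - \<eta>" "y + \<eta> \<le> b" for y \<eta>
        using W[OF that] by (simp add: gu algebra_simps)
      \<comment> \<open>One node has \<open>u = 0\<close>, the centre contributes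
        \<open>2 * D\<close> and the reflected node at least \<open>-D\<close>. Choosing the nearer
        of \<open>p\<close> and \<open>r\<close> keeps the reflected node in \<open>[a,b]\<close>
        and the step at most \<open>(b - a) / 2\<close>.\<close>
      have "D \<le> W"
      proof (cases "q - p \<le> r - q")
        case True
        then show ?thesis
          using Wu[of "q - p" q] bounds[of "q + (q - p)"] prs pqr up ur uq by auto
      next
        case False
        then show ?thesis
          using Wu[of "r - q" q] bounds[of "q - (r - q)"] prs pqr up ur uq by auto
      qed
      with bounds show ?thesis by auto
    qed
    \<comment> \<open>For \<open>D = 0\<close> the bound \<open>H\<close> makes any three points of
      the graph collinear.\<close>
    moreover have "u t = 0" if "D = 0" "t \<in> {a..b}" for t
    proof -
      consider "t < p" | "p \<le> t" "t \<le> r" | "r < t" by linarith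
      then show ?thesis
      proof cases
        case 1 then show ?thesis using H[of t p r] that prs up ur by auto
      next
        case 2 then show ?thesis using H[of p t r] that prs up ur by auto
      next
        case 3 then show ?thesis using H[of p r t] that prs up ur by auto
      qed
    qed
    moreover have "0 \<le> W" using W[of 0 a] \<open>a < b\<close> by simp
    ultimately have "\<exists>D\<le>W. \<forall>t\<in>{a..b}. -D \<le> u t \<and> u t \<le> 0"
      using D0 by (cases "D = 0") (auto intro!: exI[of _ D])
    then obtain D where D: "D \<le> W" "\<And>t. t \<in> {a..b} \<Longrightarrow> -D \<le> u t \<and> u t \<le> 0" by auto
    \<comment> \<open>As \<open>u\<close> ranges in \<open>[-D, 0]\<close>, lowering the line by
      \<open>D / 2\<close> centres the error and halves its bound.\<close>
    have "\<bar>g t - ((c - D / 2) + m * t)\<bar> \<le> W / 2" if "t \<in> {a..b}" for t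
      using D(1) D(2)[OF that, THEN conjunct1] D(2)[OF that, THEN conjunct2]
      unfolding u_def by linarith
    then show ?thesis by blast
  qed
  let ?K = "{a..b} \<times> {a..b} \<times> {0..1::real}"
  have "continuous_on ?K (dev g)"
    unfolding dev_def case_prod_unfold
  proof (intro continuous_intros continuous_on_compose2[OF cont])
    show "(\<lambda>x. (1 - snd (snd x)) * fst x + snd (snd x) * fst (snd x)) ` ?K \<subseteq> {a..b}"
    proof clarsimp
      fix p r s :: real
      assume "a \<le> p" "p \<le> b" "a \<le> r" "r \<le> b" "0 \<le> s" "s \<le> 1"
      then have "(1 - s) *\<^sub>R p + s *\<^sub>R r \<in> {a..b}"
        by (intro convexD_alt) auto
      then show "a \<le> (1 - s) * p + s * r \<and> (1 - s) * p + s * r \<le> b" by simp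
    qed
  qed auto
  then have "continuous_on ?K (\<lambda>z. \<bar>dev g z\<bar>)" by (intro continuous_intros)
  moreover have "compact ?K" by (intro compact_Times compact_Icc)
  moreover have "?K \<noteq> {}" using \<open>a < b\<close> by auto
  ultimately obtain z where z: "z \<in> ?K" "\<And>y. y \<in> ?K \<Longrightarrow> \<bar>dev g y\<bar> \<le> \<bar>dev g z\<bar>"
    using continuous_attains_sup[of ?K "\<lambda>z. \<bar>dev g z\<bar>"] by blast
  \<comment> \<open>Swapping the endpoints replaces \<open>s\<close> by \<open>1 - s\<close>. A
    maximum on the diagonal is 0, and \<open>(a, b, 0)\<close> attains it too.\<close>
  have "\<exists>p r s. p \<in> {a..b} \<and> r \<in> {a..b} \<and> s \<in> {0..1} \<and> p < r \<and> \<bar>dev g z\<bar> = \<bar>dev g (p, r, s)\<bar>"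
  proof -
    obtain p r s where zz: "z = (p, r, s)" by (cases z) auto
    consider "p < r" | "r < p" | "p = r" by linarith
    then show ?thesis
    proof cases
      case 1 then show ?thesis using z(1) zz by auto
    next
      case 2
      have "dev g (p, r, s) = dev g (r, p, 1 - s)" by (simp add: dev_def algebra_simps)
      then show ?thesis using z(1) zz 2 by (intro exI[of _ r] exI[of _ p] exI[of _ "1 - s"]) auto
    next
      case 3
      have "dev g z = 0" by (simp add: zz 3 dev_def algebra_simps)
      moreover have "dev g (a, b, 0) = 0" by (simp add: dev_def)
      ultimately show ?thesis
        using \<open>a < b\<close> by (intro exI[of _ a] exI[of _ b] exI[of _ 0]) auto
    qed
  qed
  then obtain p r s where prs: "p \<in> {a..b}" "r \<in> {a..b}" "s \<in> {0..1}" "p < r"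
    and eq: "\<bar>dev g z\<bar> = \<bar>dev g (p, r, s)\<bar>" by auto
  have dm: "dev (\<lambda>t. - g t) y = - dev g y" for y by (cases y) (simp add: dev_def)
  show ?thesis
  proof (cases "0 \<le> dev g (p, r, s)")
    case True
    then show ?thesis
      using z(2) eq prs by (intro main[OF cont W]) auto
  next
    case False
    have "\<exists>c m. \<forall>t\<in>{a..b}. \<bar>- g t - (c + m * t)\<bar> \<le> W / 2"
    proof (rule main)
      show "continuous_on {a..b} (\<lambda>t. - g t)" using cont by (intro continuous_intros)
      show "\<bar>- g (s - \<eta>) - 2 * - g s + - g (s + \<eta>)\<bar> \<le> W"
        if "0 \<le> \<eta>" "\<eta> \<le> (b - a) / 2" "a \<le> s - \<eta>" "s + \<eta> \<le> b" for s \<eta>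
        using W[OF that] by (simp add: abs_le_iff)
      show "\<bar>dev (\<lambda>t. - g t) y\<bar> \<le> dev (\<lambda>t. - g t) (p, r, s)" if "y \<in> ?K" for y
        using z(2)[OF that] eq False by (simp add: dm)
    qed (use prs in auto)
    then obtain c m where cm: "\<And>t. t \<in> {a..b} \<Longrightarrow> \<bar>- g t - (c + m * t)\<bar> \<le> W / 2" by blast
    have "\<bar>g t - (- c + (- m) * t)\<bar> \<le> W / 2" if "t \<in> {a..b}" for t
      using cm[OF that] unfolding mult_minus_left by linarith
    then show ?thesis by blast
  qed
qed


section \<open>Smoothing a function with finitely many jumps\<close>

text \<open>The derivative, set to 0 at the exceptional points, still integrates to the increment of
  the continuous function \<open>\<phi>\<close>. This form is needed because the antiderivative of a
  function with jumps is not differentiable everywhere.\<close>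

lemma deriv_nonneg_imp_le_except_finite:
  fixes \<phi> \<phi>' :: "real \<Rightarrow> real"
  assumes "finite S" "a \<le> b" "continuous_on {a..b} \<phi>"
    and deriv: "\<And>x. x \<in> {a<..<b} - S \<Longrightarrow> (\<phi> has_real_derivative \<phi>' x) (at x)"
    and nonneg: "\<And>x. x \<in> {a<..<b} - S \<Longrightarrow> 0 \<le> \<phi>' x"
  shows "\<phi> a \<le> \<phi> b"
proof -
  define \<psi> where "\<psi> x = (if x \<in> {a<..<b} - S then \<phi>' x else 0)" for x
  have "(\<psi> has_integral (\<phi> b - \<phi> a)) {a..b}"
    using assms(1-3) deriv
    by (intro fundamental_theorem_of_calculus_interior_strong)
      (auto simp: \<psi>_def simp flip: has_real_derivative_iff_has_vector_derivative)
  then have "0 \<le> \<phi> b - \<phi> a"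
    by (rule has_integral_nonneg) (use nonneg in \<open>auto simp: \<psi>_def\<close>)
  then show ?thesis by simp
qed

text \<open>The indefinite integral is continuous, and differentiable wherever the integrand is
  continuous.\<close>

lemma antiderivative_except_finite:
  fixes F :: "real \<Rightarrow> real"
  assumes int: "F integrable_on {a..b}"
    and cont: "\<And>x. x \<in> {a<..<b} - S \<Longrightarrow> isCont F x"
  obtains H where "continuous_on {a..b} H"
    and "\<And>x. x \<in> {a<..<b} - S \<Longrightarrow> (H has_real_derivative F x) (at x)"
proof
  show "continuous_on {a..b} (\<lambda>x. integral {a..x} F)"
    by (rule indefinite_integral_continuous_1[OF int])
  fix x assume x: "x \<in> {a<..<b} - S"
  have "((\<lambda>u. integral {a..u} F) has_vector_derivative F x) (at x within ({a..b} - {}))"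
    using x cont[OF x]
    by (intro integral_has_vector_derivative_continuous_at[OF int])
      (auto intro: continuous_at_imp_continuous_at_within)
  moreover have "at x within {a..b} = at x" using x by (intro at_within_Icc_at) auto
  ultimately show "((\<lambda>u. integral {a..u} F) has_real_derivative F x) (at x)"
    by (simp add: has_real_derivative_iff_has_vector_derivative)
qed

text \<open>The double Steklov average is written as a second difference of a second antiderivative
  \<open>G\<close> of \<open>F\<close>, so that its own second derivative is a second difference of \<open>F\<close>.\<close>

lemma steklov_smoothing:
  fixes F :: "real \<Rightarrow> real"
  assumes "finite S" and h: "0 < h" "h \<le> 1 / 2"
    and int: "F integrable_on {-1..2}"
    and cont: "\<And>x. x \<in> {-1<..<2} - S \<Longrightarrow> isCont F x"
    and W: "\<And>x t. \<lbrakk>0 \<le> x; x \<le> 1; 0 \<le> t; t \<le> h\<rbrakk> \<Longrightarrow> \<bar>F (x - t) - 2 * F x + F (x + t)\<bar> \<le> W"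
  obtains \<phi> where "\<And>x. x \<in> {0..1} \<Longrightarrow> \<bar>\<phi> x - F x\<bar> \<le> W / 2"
    and "convex_on {0..1} (\<lambda>x. W / h\<^sup>2 / 2 * x\<^sup>2 + \<phi> x)"
    and "convex_on {0..1} (\<lambda>x. W / h\<^sup>2 / 2 * x\<^sup>2 - \<phi> x)"
proof -
  obtain H where H: "continuous_on {-1..2} H"
    and H': "\<And>x. x \<in> {-1<..<2} - S \<Longrightarrow> (H has_real_derivative F x) (at x)"
    using antiderivative_except_finite[OF int cont] by metis
  \<comment> \<open>The jumps of \<open>F\<close> affect only the differentiability of
    \<open>H\<close>. Being continuous, \<open>H\<close> has an antiderivative \<open>G\<close>
    without exceptional points.\<close>
  have "isCont H x" if "x \<in> {-1<..<2} - {}" for x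
    using continuous_on_interior[OF H] that by simp
  then obtain G where G': "\<And>x. x \<in> {-1<..<2} \<Longrightarrow> (G has_real_derivative H x) (at x)"
    using antiderivative_except_finite[OF integrable_continuous_real[OF H], of "{}"]
    by (metis Diff_empty)
  have DH: "((\<lambda>t. H (u t)) has_real_derivative F (u t) * u') (at t)"
    if "(u has_real_derivative u') (at t)" "u t \<in> {-1<..<2} - S" for u u' t
    using DERIV_chain2[OF H'[OF that(2)] that(1)] .
  have DG: "((\<lambda>t. G (u t)) has_real_derivative H (u t) * u') (at t)"
    if "(u has_real_derivative u') (at t)" "u t \<in> {-1<..<2}" for u u' t
    using DERIV_chain2[OF G'[OF that(2)] that(1)] .
  have lin: "((\<lambda>s. x + s) has_real_derivative 1) (at s)"
    "((\<lambda>s. x - s) has_real_derivative -1) (at s)"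
    "((\<lambda>s. s + x) has_real_derivative 1) (at s)"
    "((\<lambda>s. s - x) has_real_derivative 1) (at s)" for x s :: real
    by (auto intro!: derivative_eq_intros)
  define \<phi> where "\<phi> x = (G (x + h) - 2 * G x + G (x - h)) / h\<^sup>2" for x

  have close: "\<bar>\<phi> x - F x\<bar> \<le> W / 2" if x: "x \<in> {0..1}" for x
  proof -
    \<comment> \<open>First integration in \<open>t\<close> of the bound on second differences of
      \<open>F\<close>. The set \<open>?S\<close> collects the finitely many steps at which
      \<open>x + s\<close> or \<open>x - s\<close> meets \<open>S\<close>.\<close>
    have Hbound: "\<bar>H (x + t) - H (x - t) - 2 * t * F x\<bar> \<le> W * t" if t: "0 \<le> t" "t \<le> h" for t
    proof -
      let ?S = "(\<lambda>s. s - x) ` S \<union> (\<lambda>s. x - s) ` S"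
      have fin: "finite ?S" using \<open>finite S\<close> by simp
      have S: "x + s \<notin> S \<and> x - s \<notin> S" if "s \<notin> ?S" for s
      proof -
        have "s = (x + s) - x" "s = x - (x - s)" by auto
        with that show ?thesis by blast
      qed
      have c: "continuous_on {0..t} (\<lambda>s. H (x + s))" "continuous_on {0..t} (\<lambda>s. H (x - s))"
        using x t h by (auto intro!: continuous_on_compose2[OF H] continuous_intros)
      have D: "((\<lambda>s. H (x + s)) has_real_derivative F (x + s)) (at s)"
        "((\<lambda>s. H (x - s)) has_real_derivative - F (x - s)) (at s)"
        if "s \<in> {0<..<t} - ?S" for s
        using x t h that S[of s] DH[OF lin(1), of x s] DH[OF lin(2), of x s] by auto
      have B: "\<bar>F (x - s) - 2 * F x + F (x + s)\<bar> \<le> W" if "s \<in> {0<..<t} - ?S" for s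
        using W[of x s] x t that by auto
      have 1: "W * 0 - (H (x + 0) - H (x - 0) - 2 * 0 * F x)
          \<le> W * t - (H (x + t) - H (x - t) - 2 * t * F x)"
        using fin t(1)
      proof (rule deriv_nonneg_imp_le_except_finite)
        show "continuous_on {0..t} (\<lambda>s. W * s - (H (x + s) - H (x - s) - 2 * s * F x))"
          by (intro continuous_intros c)
        show "((\<lambda>s. W * s - (H (x + s) - H (x - s) - 2 * s * F x)) has_real_derivative
            W - (F (x + s) + F (x - s) - 2 * F x)) (at s)" if "s \<in> {0<..<t} - ?S" for s
          by (rule derivative_eq_intros D that refl | simp)+
        show "0 \<le> W - (F (x + s) + F (x - s) - 2 * F x)" if "s \<in> {0<..<t} - ?S" for s
          using B[OF that] by linarith
      qed
      have 2: "W * 0 + (H (x + 0) - H (x - 0) - 2 * 0 * F x)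
          \<le> W * t + (H (x + t) - H (x - t) - 2 * t * F x)"
        using fin t(1)
      proof (rule deriv_nonneg_imp_le_except_finite)
        show "continuous_on {0..t} (\<lambda>s. W * s + (H (x + s) - H (x - s) - 2 * s * F x))"
          by (intro continuous_intros c)
        show "((\<lambda>s. W * s + (H (x + s) - H (x - s) - 2 * s * F x)) has_real_derivative
            W + (F (x + s) + F (x - s) - 2 * F x)) (at s)" if "s \<in> {0<..<t} - ?S" for s
          by (rule derivative_eq_intros D that refl | simp)+
        show "0 \<le> W + (F (x + s) + F (x - s) - 2 * F x)" if "s \<in> {0<..<t} - ?S" for s
          using B[OF that] by linarith
      qed
      show ?thesis using 1 2 by simp
    qed
    \<comment> \<open>Second integration: \<open>\<psi>\<close> vanishes at 0, its derivative is the
      quantity in \<open>Hbound\<close>, and its value at \<open>h\<close> is the error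
      \<open>\<phi> x - F x\<close> times \<open>h\<^sup>2\<close>. Integrating \<open>W * t\<close>
      produces the factor 1/2.\<close>
    define \<psi> where "\<psi> t = G (x + t) + G (x - t) - 2 * G x - t\<^sup>2 * F x" for t
    have \<psi>': "(\<psi> has_real_derivative H (x + t) - H (x - t) - 2 * t * F x) (at t)"
      if "0 \<le> t" "t \<le> h" for t
    proof -
      have "((\<lambda>s. G (x + s)) has_real_derivative H (x + t)) (at t)"
        "((\<lambda>s. G (x - s)) has_real_derivative - H (x - t)) (at t)"
        using x h that DG[OF lin(1), of x t] DG[OF lin(2), of x t] by auto
      then show ?thesis unfolding \<psi>_def by (auto intro!: derivative_eq_intros)
    qed
    have "W * 0\<^sup>2 / 2 - \<psi> 0 \<le> W * h\<^sup>2 / 2 - \<psi> h"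
    proof (rule DERIV_nonneg_imp_nondecreasing[where f = "\<lambda>t. W * t\<^sup>2 / 2 - \<psi> t"])
      fix t assume t: "0 \<le> t" "t \<le> h"
      have "((\<lambda>t. W * t\<^sup>2 / 2 - \<psi> t) has_real_derivative
          W * t - (H (x + t) - H (x - t) - 2 * t * F x)) (at t)"
        by (rule derivative_eq_intros \<psi>' t refl | simp)+
      moreover have "0 \<le> W * t - (H (x + t) - H (x - t) - 2 * t * F x)"
        using Hbound[OF t] by linarith
      ultimately show "\<exists>y. ((\<lambda>t. W * t\<^sup>2 / 2 - \<psi> t) has_real_derivative y) (at t) \<and> 0 \<le> y"
        by blast
    qed (use h in auto)
    moreover have "W * 0\<^sup>2 / 2 + \<psi> 0 \<le> W * h\<^sup>2 / 2 + \<psi> h"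
    proof (rule DERIV_nonneg_imp_nondecreasing[where f = "\<lambda>t. W * t\<^sup>2 / 2 + \<psi> t"])
      fix t assume t: "0 \<le> t" "t \<le> h"
      have "((\<lambda>t. W * t\<^sup>2 / 2 + \<psi> t) has_real_derivative
          W * t + (H (x + t) - H (x - t) - 2 * t * F x)) (at t)"
        by (rule derivative_eq_intros \<psi>' t refl | simp)+
      moreover have "0 \<le> W * t + (H (x + t) - H (x - t) - 2 * t * F x)"
        using Hbound[OF t] by linarith
      ultimately show "\<exists>y. ((\<lambda>t. W * t\<^sup>2 / 2 + \<psi> t) has_real_derivative y) (at t) \<and> 0 \<le> y"
        by blast
    qed (use h in auto)
    moreover have "\<psi> 0 = 0" by (simp add: \<psi>_def)
    ultimately have "\<bar>\<psi> h\<bar> \<le> W * h\<^sup>2 / 2" unfolding abs_le_iff by auto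
    moreover have "\<psi> h = (\<phi> x - F x) * h\<^sup>2" using h by (simp add: \<psi>_def \<phi>_def field_simps)
    ultimately have "\<bar>\<phi> x - F x\<bar> * h\<^sup>2 \<le> W / 2 * h\<^sup>2" by (simp add: abs_mult)
    then show ?thesis using h by (simp del: times_divide_eq_left)
  qed

  define \<phi>' where "\<phi>' x = (H (x + h) - 2 * H x + H (x - h)) / h\<^sup>2" for x
  have D\<phi>: "(\<phi> has_real_derivative \<phi>' x) (at x)" if "x \<in> {0..1}" for x
  proof -
    have "((\<lambda>s. G (s + h)) has_real_derivative H (x + h) * 1) (at x)"
      "((\<lambda>s. G (s - h)) has_real_derivative H (x - h) * 1) (at x)"
      "(G has_real_derivative H x) (at x)"
      using h that by (auto intro!: DG[OF lin(3)] DG[OF lin(4)] G' simp del: mult_1_right)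
    then show ?thesis unfolding \<phi>_def \<phi>'_def
      by (intro DERIV_cdivide) (auto intro!: derivative_eq_intros)
  qed
  \<comment> \<open>The second derivative of \<open>\<phi>\<close>, a second difference of
    \<open>F\<close> over \<open>h\<^sup>2\<close>, is available only off finitely many points.
    Convexity is therefore obtained from a monotone first derivative; \<open>\<sigma>\<close> treats
    both signs at once.\<close>
  have mono: "W / h\<^sup>2 * x + \<sigma> * \<phi>' x \<le> W / h\<^sup>2 * y + \<sigma> * \<phi>' y"
    if xy: "0 \<le> x" "x \<le> y" "y \<le> 1" and \<sigma>: "\<sigma> = 1 \<or> \<sigma> = -1" for x y \<sigma>
  proof -
    let ?S = "(\<lambda>s. s - h) ` S \<union> (\<lambda>s. s + h) ` S \<union> S"
    have fin: "finite ?S" using \<open>finite S\<close> by simp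
    have S: "s + h \<notin> S \<and> s - h \<notin> S \<and> s \<notin> S" if "s \<notin> ?S" for s
    proof -
      have "s = (s + h) - h" "s = (s - h) + h" by auto
      with that show ?thesis by blast
    qed
    have c: "continuous_on {x..y} (\<lambda>s. H (s + h))" "continuous_on {x..y} (\<lambda>s. H (s - h))"
      "continuous_on {x..y} H"
      using xy h by (auto intro!: continuous_on_compose2[OF H] continuous_intros
          intro: continuous_on_subset[OF H])
    show ?thesis
      using fin \<open>x \<le> y\<close>
    proof (rule deriv_nonneg_imp_le_except_finite)
      show "continuous_on {x..y} (\<lambda>s. W / h\<^sup>2 * s + \<sigma> * \<phi>' s)"
        unfolding \<phi>'_def using h by (intro continuous_intros c) auto
      fix s assume s: "s \<in> {x<..<y} - ?S"
      have "((\<lambda>s. H (s + h)) has_real_derivative F (s + h) * 1) (at s)"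
        "((\<lambda>s. H (s - h)) has_real_derivative F (s - h) * 1) (at s)"
        "(H has_real_derivative F s) (at s)"
        using S[of s] s xy h by (auto intro!: DH[OF lin(3)] DH[OF lin(4)] H' simp del: mult_1_right)
      then show "((\<lambda>s. W / h\<^sup>2 * s + \<sigma> * \<phi>' s) has_real_derivative
          (W + \<sigma> * (F (s - h) - 2 * F s + F (s + h))) / h\<^sup>2) (at s)"
        unfolding \<phi>'_def using h by (auto intro!: derivative_eq_intros simp: field_simps)
      have "0 \<le> W + \<sigma> * (F (s - h) - 2 * F s + F (s + h))"
        using W[of s h] s xy h \<sigma> by auto
      then show "0 \<le> (W + \<sigma> * (F (s - h) - 2 * F s + F (s + h))) / h\<^sup>2" by simp
    qed
  qed
  have D: "((\<lambda>x. K / 2 * x\<^sup>2 + \<sigma> * \<phi> x) has_real_derivative K * x + \<sigma> * \<phi>' x) (at x)"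
    if "x \<in> {0..1}" for x \<sigma> K
    using D\<phi>[OF that] by (auto intro!: derivative_eq_intros)
  have convex: "convex_on {0..1} (\<lambda>x. W / h\<^sup>2 / 2 * x\<^sup>2 + \<sigma> * \<phi> x)" if "\<sigma> = 1 \<or> \<sigma> = -1" for \<sigma>
  proof (rule convex_on_realI[OF _ D])
    show "W / h\<^sup>2 * x + \<sigma> * \<phi>' x \<le> W / h\<^sup>2 * y + \<sigma> * \<phi>' y"
      if "x \<in> {0..1}" "y \<in> {0..1}" "x \<le> y" for x y
      using mono that \<open>\<sigma> = 1 \<or> \<sigma> = -1\<close> by auto
  qed auto
  show ?thesis
    by (rule that[OF close]) (use convex[of 1] convex[of "-1"] in auto)
qed


section \<open>Positive operators given by finite averages\<close>

text \<open>With finite averages of point evaluations, linearity, positivity and composition become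
  computations with sums, valid for arbitrary \<open>g\<close>. Continuous weights keep partially
  averaged functions continuous on the cube.\<close>

definition averaging_op :: "((real \<Rightarrow> real) \<Rightarrow> real \<Rightarrow> real) \<Rightarrow> bool" where
  "averaging_op A \<longleftrightarrow> (\<exists>(N::nat) w z. (\<forall>j. z j \<in> {0..1} \<and> continuous_on {0..1} (w j))
     \<and> (\<forall>x\<in>{0..1}. (\<forall>j. 0 \<le> w j x) \<and> (\<Sum>j\<le>N. w j x) = 1)
     \<and> (\<forall>g x. A g x = (\<Sum>j\<le>N. w j x * g (z j))))"

lemma averaging_opE:
  assumes "averaging_op A"
  obtains z w and N :: nat where "\<And>j. z j \<in> {0..1}" "\<And>j. continuous_on {0..1} (w j)"
    "\<And>j x. x \<in> {0..1} \<Longrightarrow> 0 \<le> w j x" "\<And>x. x \<in> {0..1} \<Longrightarrow> (\<Sum>j\<le>N. w j x) = 1"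
    "\<And>g x. A g x = (\<Sum>j\<le>N. w j x * g (z j))"
proof -
  obtain N w z where A: "(\<forall>j. z j \<in> {0..1} \<and> continuous_on {0..1} (w j))
     \<and> (\<forall>x\<in>{0..1}. (\<forall>j. 0 \<le> w j x) \<and> (\<Sum>j\<le>N. w j x) = 1)
     \<and> (\<forall>g x. A g x = (\<Sum>j\<le>(N::nat). w j x * g (z j)))"
    using assms unfolding averaging_op_def by (elim exE) (rule that)
  show thesis
    by (rule that[of z w N])
      (rule A[THEN conjunct1, rule_format, THEN conjunct1]
        A[THEN conjunct1, rule_format, THEN conjunct2]
        A[THEN conjunct2, THEN conjunct1, rule_format, THEN conjunct1, rule_format]
        A[THEN conjunct2, THEN conjunct1, rule_format, THEN conjunct2]
        A[THEN conjunct2, THEN conjunct2, rule_format], assumption?)+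
qed

lemma averaging_op_add:
  "averaging_op A \<Longrightarrow> A (\<lambda>t. f t + g t) x = A f x + A g x"
  by (erule averaging_opE) (simp add: algebra_simps sum.distrib)

lemma averaging_op_diff:
  "averaging_op A \<Longrightarrow> A (\<lambda>t. f t - g t) x = A f x - A g x"
  by (erule averaging_opE) (simp add: algebra_simps sum_subtractf)

lemma averaging_op_cmult:
  "averaging_op A \<Longrightarrow> A (\<lambda>t. c * f t) x = c * A f x"
  by (erule averaging_opE) (simp add: sum_distrib_left mult_ac)

lemma averaging_op_const:
  "averaging_op A \<Longrightarrow> x \<in> {0..1} \<Longrightarrow> A (\<lambda>t. c) x = c"
  by (erule averaging_opE) (simp flip: sum_distrib_right)

lemma averaging_op_mono:
  assumes "averaging_op A" "x \<in> {0..1}" "\<And>t. t \<in> {0..1} \<Longrightarrow> f t \<le> g t"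
  shows "A f x \<le> A g x"
  using assms(1) by (rule averaging_opE) (use assms in \<open>auto intro!: sum_mono mult_left_mono\<close>)

lemma averaging_op_abs_le:
  assumes A: "averaging_op A" and x: "x \<in> {0..1}" and M: "\<And>t. t \<in> {0..1} \<Longrightarrow> \<bar>f t\<bar> \<le> M"
  shows "\<bar>A f x\<bar> \<le> M"
proof -
  have "A f x \<le> A (\<lambda>t. M) x"
    by (rule averaging_op_mono[OF A x]) (use M abs_le_D1 in blast)
  moreover have "A (\<lambda>t. - M) x \<le> A f x"
    by (rule averaging_op_mono[OF A x]) (use M in fastforce)
  ultimately show ?thesis by (simp add: averaging_op_const[OF A x])
qed

text \<open>The composite keeps the nodes of \<open>B\<close>; its weights are those of
  \<open>A\<close> multiplied by the matrix of values \<open>v j (z i)\<close>, so their continuity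
  comes from \<open>A\<close>.\<close>

lemma averaging_op_comp:
  assumes "averaging_op A" "averaging_op B"
  shows "averaging_op (A \<circ> B)"
proof -
  obtain N w z where A: "(\<forall>j. z j \<in> {0..1} \<and> continuous_on {0..1} (w j))
     \<and> (\<forall>x\<in>{0..1}. (\<forall>j. 0 \<le> w j x) \<and> (\<Sum>j\<le>N. w j x) = 1)
     \<and> (\<forall>g x. A g x = (\<Sum>j\<le>(N::nat). w j x * g (z j)))"
    using assms(1) unfolding averaging_op_def by (elim exE) (rule that)
  obtain M v y where B: "(\<forall>j. y j \<in> {0..1} \<and> continuous_on {0..1} (v j))
     \<and> (\<forall>x\<in>{0..1}. (\<forall>j. 0 \<le> v j x) \<and> (\<Sum>j\<le>M. v j x) = 1)
     \<and> (\<forall>g x. B g x = (\<Sum>j\<le>(M::nat). v j x * g (y j)))"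
    using assms(2) unfolding averaging_op_def by (elim exE) (rule that)
  note A1 = A[THEN conjunct1, rule_format] and B1 = B[THEN conjunct1, rule_format]
  note A2 = A[THEN conjunct2, THEN conjunct1, rule_format]
    and B2 = B[THEN conjunct2, THEN conjunct1, rule_format]
  note A3 = A[THEN conjunct2, THEN conjunct2, rule_format]
    and B3 = B[THEN conjunct2, THEN conjunct2, rule_format]
  define u where "u j x = (\<Sum>i\<le>N. w i x * v j (z i))" for j x
  show ?thesis
    unfolding averaging_op_def
  proof (intro exI conjI allI ballI)
    show "y j \<in> {0..1}" for j by (rule B1[THEN conjunct1])
    show "continuous_on {0..1} (u j)" for j
      unfolding u_def by (intro continuous_on_sum continuous_on_mult_right A1[THEN conjunct2])
    show "0 \<le> u j x" if "x \<in> {0..1}" for j x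
      unfolding u_def
      by (intro sum_nonneg mult_nonneg_nonneg A2[OF that, THEN conjunct1, rule_format]
          B2[THEN conjunct1, rule_format] A1[THEN conjunct1])
    show "(\<Sum>j\<le>M. u j x) = 1" if "x \<in> {0..1}" for x
    proof -
      have "(\<Sum>j\<le>M. u j x) = (\<Sum>i\<le>N. w i x * (\<Sum>j\<le>M. v j (z i)))"
        unfolding u_def sum_distrib_left by (rule sum.swap)
      also have "\<dots> = (\<Sum>i\<le>N. w i x * 1)"
        by (simp only: B2[OF A1[THEN conjunct1], THEN conjunct2])
      also have "\<dots> = 1"
        by (simp only: mult_1_right A2[OF that, THEN conjunct2])
      finally show ?thesis .
    qed
    show "(A \<circ> B) g x = (\<Sum>j\<le>M. u j x * g (y j))" for g x
    proof -
      have "(A \<circ> B) g x = (\<Sum>i\<le>N. \<Sum>j\<le>M. w i x * v j (z i) * g (y j))"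
        by (simp only: o_apply A3 B3 sum_distrib_left mult.assoc)
      also have "\<dots> = (\<Sum>j\<le>M. \<Sum>i\<le>N. w i x * v j (z i) * g (y j))"
        by (rule sum.swap)
      finally show ?thesis by (simp only: u_def sum_distrib_right)
    qed
  qed
qed

lemma averaging_op_bernstein:
  assumes "l \<ge> 1"
  shows "averaging_op (bernstein_op l)"
  unfolding averaging_op_def
proof (intro exI conjI allI ballI)
  \<comment> \<open>Indices above \<open>l\<close> get the node 0, so that every node lies in
    \<open>[0,1]\<close>.\<close>
  let ?z = "\<lambda>k. if k \<le> l then real k / real l else 0"
  show "?z k \<in> {0..1}" for k by (auto simp: divide_le_eq_1)
  show "continuous_on {0..1} (Bernstein l k)" for k
    unfolding Bernstein_def by (intro continuous_intros)
  show "0 \<le> Bernstein l k x" if "x \<in> {0..1}" for k x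
    using that by (auto intro: Bernstein_nonneg)
  show "bernstein_op l g x = (\<Sum>k\<le>l. Bernstein l k x * g (?z k))" for g x
    unfolding bernstein_op_def by (intro sum.cong) auto
qed (rule sum_Bernstein)

text \<open>The induction starts at 1, since the identity is not an average over finitely many fixed
  nodes.\<close>

lemma averaging_op_bernstein_pow:
  assumes "l \<ge> 1" "n \<ge> 1"
  shows "averaging_op (bernstein_op l ^^ n)"
  using \<open>n \<ge> 1\<close>
proof (induction n rule: dec_induct)
  case base
  then show ?case using averaging_op_bernstein[OF assms(1)] by simp
next
  case (step n)
  have "averaging_op (bernstein_op l \<circ> (bernstein_op l ^^ n))"
    by (intro averaging_op_comp averaging_op_bernstein assms(1) step.IH)
  then show ?case by (simp only: funpow.simps)
qed

section \<open>Bernstein iterates on affine, quadratic and convex functions\<close>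

lemma bernstein_op_affine:
  assumes "l \<ge> 1"
  shows "bernstein_op l (\<lambda>t. c + m * t) = (\<lambda>t. c + m * t)"
proof
  fix x
  have "bernstein_op l (\<lambda>t. c + m * t) x
      = c * (\<Sum>k\<le>l. Bernstein l k x) + m / l * (\<Sum>k\<le>l. k * Bernstein l k x)"
    unfolding bernstein_op_def sum_distrib_left by (simp add: algebra_simps flip: sum.distrib)
  then show "bernstein_op l (\<lambda>t. c + m * t) x = c + m * x" using assms by simp
qed

text \<open>The parabola is an eigenfunction with eigenvalue \<open>1 - 1/l\<close>. At
  \<open>k/l\<close> it equals \<open>((l - 1) * k - k * (k - 1)) / l\<^sup>2\<close>, which reduces
  the claim to the first two factorial moments. The factor \<open>c\<close> lets the identity be
  applied again to its own result.\<close>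

lemma bernstein_op_parabola:
  assumes "l \<ge> 1"
  shows "bernstein_op l (\<lambda>t. c * (t * (1 - t))) = (\<lambda>t. (1 - 1 / real l) * c * (t * (1 - t)))"
proof
  fix x
  have "bernstein_op l (\<lambda>t. c * (t * (1 - t))) x
      = (\<Sum>k\<le>l. c * (real l - 1) / l\<^sup>2 * (k * Bernstein l k x)
          - c / l\<^sup>2 * (k * (real k - 1) * Bernstein l k x))"
    unfolding bernstein_op_def
    using assms by (intro sum.cong) (auto simp: field_simps power2_eq_square)
  also have "\<dots> = c * (real l - 1) / l\<^sup>2 * (l * x) - c / l\<^sup>2 * (l * (real l - 1) * x\<^sup>2)"
    unfolding sum_subtractf by (simp only: sum_k_Bernstein sum_kk_Bernstein flip: sum_distrib_left)
  also have "\<dots> = (1 - 1 / real l) * c * (x * (1 - x))"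
    using assms by (simp add: field_simps power2_eq_square)
  finally show "bernstein_op l (\<lambda>t. c * (t * (1 - t))) x = (1 - 1 / real l) * c * (x * (1 - x))" .
qed

lemma bernstein_pow_affine:
  "l \<ge> 1 \<Longrightarrow> (bernstein_op l ^^ n) (\<lambda>t. c + m * t) = (\<lambda>t. c + m * t)"
  by (induction n) (simp_all add: bernstein_op_affine)

lemma bernstein_pow_parabola:
  "l \<ge> 1 \<Longrightarrow> (bernstein_op l ^^ n) (\<lambda>t. t * (1 - t)) = (\<lambda>t. (1 - 1 / real l) ^ n * (t * (1 - t)))"
proof (induction n)
  case (Suc n)
  then show ?case using bernstein_op_parabola[OF Suc.prems] by (simp add: mult.assoc)
qed simp

lemma bernstein_op_1: "bernstein_op 1 g = (\<lambda>x. g 0 + (g 1 - g 0) * x)"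
  by (auto simp: bernstein_op_def Bernstein_def algebra_simps)

text \<open>The first application yields the chord of \<open>g\<close>, which all later ones
  reproduce.\<close>

lemma bernstein_1_pow:
  assumes "n \<ge> 1"
  shows "(bernstein_op 1 ^^ n) g = (\<lambda>x. g 0 + (g 1 - g 0) * x)"
proof -
  obtain k where "n = Suc k" using assms by (cases n) auto
  then show ?thesis
    using bernstein_pow_affine[of 1 k] by (simp add: funpow_Suc_right bernstein_op_1 del: funpow.simps One_nat_def)
qed

lemma bernstein_op_endpoints:
  assumes "l \<ge> 1"
  shows "bernstein_op l g 0 = g 0" "bernstein_op l g 1 = g 1"
proof -
  have "bernstein_op l g 0 = (\<Sum>k\<le>l. if k = 0 then g 0 else 0)"
    unfolding bernstein_op_def Bernstein_def by (intro sum.cong) auto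
  then show "bernstein_op l g 0 = g 0" by simp
  have "bernstein_op l g 1 = (\<Sum>k\<le>l. if k = l then g 1 else 0)"
    unfolding bernstein_op_def Bernstein_def using assms by (intro sum.cong) auto
  then show "bernstein_op l g 1 = g 1" by simp
qed

lemma bernstein_pow_endpoints:
  assumes "l \<ge> 1"
  shows "(bernstein_op l ^^ n) g 0 = g 0" "(bernstein_op l ^^ n) g 1 = g 1"
  by (induction n) (simp_all add: bernstein_op_endpoints[OF assms])

text \<open>A convex function lies below its chord over \<open>[0,1]\<close>. The positive operator
  on the left reproduces that chord, which is the right-hand side.\<close>

lemma bernstein_pow_convex_le:
  assumes "l \<ge> 1" "n \<ge> 1" "convex_on {0..1} g" "x \<in> {0..1}"
  shows "(bernstein_op l ^^ n) g x \<le> (bernstein_op 1 ^^ n) g x"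
proof -
  have "(bernstein_op l ^^ n) g x \<le> (bernstein_op l ^^ n) (\<lambda>t. g 0 + (g 1 - g 0) * t) x"
  proof (rule averaging_op_mono[OF averaging_op_bernstein_pow[OF assms(1,2)] assms(4)])
    fix t :: real assume "t \<in> {0..1}"
    then have "g ((1 - t) *\<^sub>R 0 + t *\<^sub>R 1) \<le> (1 - t) * g 0 + t * g 1"
      by (intro convex_onD[OF assms(3)]) auto
    then show "g t \<le> g 0 + (g 1 - g 0) * t" by (simp add: algebra_simps)
  qed
  also have "\<dots> = (bernstein_op 1 ^^ n) g x"
    using assms by (simp add: bernstein_pow_affine bernstein_1_pow del: One_nat_def)
  finally show ?thesis .
qed

section \<open>Extension beyond the interval and the univariate estimate\<close>

text \<open>Zhuk's extension of \<open>g\<close> beyond \<open>[0,1]\<close> by its best affine approximations near the two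
  endpoints; it may jump at \<open>0\<close> and \<open>1\<close>.\<close>

lemma zhuk_extension:
  fixes g :: "real \<Rightarrow> real"
  assumes h: "0 < h" "h \<le> 1 / 2" and cont: "continuous_on {0..1} g"
    and W: "\<And>s \<eta>. \<lbrakk>0 \<le> \<eta>; \<eta> \<le> h; 0 \<le> s - \<eta>; s + \<eta> \<le> 1\<rbrakk>
      \<Longrightarrow> \<bar>g (s - \<eta>) - 2 * g s + g (s + \<eta>)\<bar> \<le> W"
  obtains F where "\<And>x. x \<in> {0..1} \<Longrightarrow> F x = g x" "F integrable_on {-1..2}"
    "\<And>x. x \<in> {-1<..<2} - {0, 1} \<Longrightarrow> isCont F x"
    "\<And>x t. \<lbrakk>0 \<le> x; x \<le> 1; 0 \<le> t; t \<le> h\<rbrakk> \<Longrightarrow> \<bar>F (x - t) - 2 * F x + F (x + t)\<bar> \<le> 3 / 2 * W"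
proof -
  \<comment> \<open>An interval of length \<open>2 * h\<close> has half-length \<open>h\<close>, so
    only steps covered by \<open>W\<close> occur; \<open>h \<le> 1/2\<close> keeps it inside
    \<open>[0,1]\<close>.\<close>
  have "\<exists>c m. \<forall>t\<in>{0..2*h}. \<bar>g t - (c + m * t)\<bar> \<le> W / 2"
    using h by (intro second_difference_best_affine W continuous_on_subset[OF cont]) auto
  then obtain c1 m1 where P1: "\<And>t. 0 \<le> t \<Longrightarrow> t \<le> 2 * h \<Longrightarrow> \<bar>g t - (c1 + m1 * t)\<bar> \<le> W / 2"
    by (metis atLeastAtMost_iff)
  have "\<exists>c m. \<forall>t\<in>{1-2*h..1}. \<bar>g t - (c + m * t)\<bar> \<le> W / 2"
    using h by (intro second_difference_best_affine W continuous_on_subset[OF cont]) auto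
  then obtain c2 m2 where P2: "\<And>t. 1 - 2 * h \<le> t \<Longrightarrow> t \<le> 1 \<Longrightarrow> \<bar>g t - (c2 + m2 * t)\<bar> \<le> W / 2"
    by (metis atLeastAtMost_iff)
  define F where "F x = (if x < 0 then c1 + m1 * x else if x \<le> 1 then g x else c2 + m2 * x)" for x
  have "0 \<le> W" using W[of 0 0] h by simp
  show ?thesis
  proof (rule that)
    show "F x = g x" if "x \<in> {0..1}" for x using that by (simp add: F_def)
    have "F integrable_on {-1..0}"
      by (rule integrable_spike_finite[of "{0}" _ _ "\<lambda>x. c1 + m1 * x"])
        (auto simp: F_def intro!: integrable_continuous_real continuous_intros)
    moreover have "F integrable_on {0..1}"
      by (rule integrable_spike_finite[of "{}" _ _ g])
        (auto simp: F_def intro!: integrable_continuous_real cont)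
    moreover have "F integrable_on {1..2}"
      by (rule integrable_spike_finite[of "{1}" _ _ "\<lambda>x. c2 + m2 * x"])
        (auto simp: F_def intro!: integrable_continuous_real continuous_intros)
    ultimately show "F integrable_on {-1..2}"
      by (meson Henstock_Kurzweil_Integration.integrable_combine neg_le_0_iff_le zero_le_one
          one_le_numeral order_trans zero_le_numeral)
    show "isCont F x" if x: "x \<in> {-1<..<2} - {0, 1}" for x
    proof -
      have "continuous_on {..<0} F"
        by (subst continuous_on_cong[OF refl, of _ _ "\<lambda>x. c1 + m1 * x"])
          (auto simp: F_def intro!: continuous_intros)
      moreover have "continuous_on {0<..<1} F"
        by (subst continuous_on_cong[OF refl, of _ _ g])
          (auto simp: F_def intro: continuous_on_subset[OF cont])
      moreover have "continuous_on {1<..} F"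
        by (subst continuous_on_cong[OF refl, of _ _ "\<lambda>x. c2 + m2 * x"])
          (auto simp: F_def intro!: continuous_intros)
      moreover consider "x \<in> {..<0}" | "x \<in> {0<..<1}" | "x \<in> {1<..}" using x by fastforce
      ultimately show ?thesis
        by (metis continuous_on_eq_continuous_at open_greaterThan open_greaterThanLessThan
            open_lessThan)
    qed
    show "\<bar>F (x - t) - 2 * F x + F (x + t)\<bar> \<le> 3 / 2 * W"
      if xt: "0 \<le> x" "x \<le> 1" "0 \<le> t" "t \<le> h" for x t
    proof -
      consider "0 \<le> x - t" "x + t \<le> 1" | "x - t < 0" | "1 < x + t" by linarith
      then show ?thesis
      proof cases
        case 1
        then show ?thesis using W[of t x] xt \<open>0 \<le> W\<close> by (simp add: F_def)
      next
        \<comment> \<open>Here \<open>x < t \<le> h\<close> puts \<open>x\<close> and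
          \<open>x + t\<close> into \<open>[0, 2 * h]\<close>. The outer node lies on the line, so
          the error is at most \<open>2 * (W / 2) + W / 2\<close>.\<close>
        case 2
        then have "F (x - t) = c1 + (m1 * x - m1 * t)" "F x = g x" "F (x + t) = g (x + t)"
          using xt h by (auto simp: F_def algebra_simps)
        moreover have "\<bar>g x - (c1 + m1 * x)\<bar> \<le> W / 2" "\<bar>g (x + t) - (c1 + (m1 * x + m1 * t))\<bar> \<le> W / 2"
          using P1[of x] P1[of "x + t"] 2 xt h by (auto simp: distrib_left)
        ultimately show ?thesis by linarith
      next
        case 3
        then have "F (x + t) = c2 + (m2 * x + m2 * t)" "F x = g x" "F (x - t) = g (x - t)"
          using xt h by (auto simp: F_def algebra_simps)
        moreover have "\<bar>g x - (c2 + m2 * x)\<bar> \<le> W / 2" "\<bar>g (x - t) - (c2 + (m2 * x - m2 * t))\<bar> \<le> W / 2"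
          using P2[of x] P2[of "x - t"] 3 xt h by (auto simp: right_diff_distrib)
        ultimately show ?thesis by linarith
      qed
    qed
  qed
qed

text \<open>Split \<open>g\<close> into \<open>\<phi>\<close> and \<open>g - \<phi>\<close>:
  convexity controls the first part, closeness the second under each operator. Allowing any bound
  \<open>W\<close> in place of a modulus makes the estimate applicable to sections of partially
  averaged functions.\<close>

lemma bernstein_pow_diff_le:
  fixes g :: "real \<Rightarrow> real"
  assumes l: "l \<ge> 1" and n: "n \<ge> 1" and cont: "continuous_on {0..1} g" and x: "x \<in> {0..1}"
    and h_def: "h = sqrt (x * (1 - x) * (1 - 1 / real l) ^ n)"
    and W: "\<And>s \<eta>. \<lbrakk>0 \<le> \<eta>; \<eta> \<le> h; 0 \<le> s - \<eta>; s + \<eta> \<le> 1\<rbrakk>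
      \<Longrightarrow> \<bar>g (s - \<eta>) - 2 * g s + g (s + \<eta>)\<bar> \<le> W"
  shows "\<bar>(bernstein_op l ^^ n) g x - (bernstein_op 1 ^^ n) g x\<bar> \<le> 9 / 4 * W"
proof -
  define L where "L = bernstein_op l ^^ n"
  define B where "B = bernstein_op 1 ^^ n"
  note LB = L_def B_def
  have q: "0 \<le> 1 - 1 / real l" "1 - 1 / real l \<le> 1" using l by (auto simp: divide_le_eq_1)
  have h2: "h\<^sup>2 = x * (1 - x) * (1 - 1 / real l) ^ n" and "0 \<le> h"
    using x q by (auto simp: h_def)
  have "0 \<le> W" using W[of 0 0] \<open>0 \<le> h\<close> by simp
  show ?thesis
  proof (cases "h = 0")
    \<comment> \<open>No smoothing step is available, but the two operators agree: at the endpoints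
      both interpolate \<open>g\<close>, and for \<open>l = 1\<close> they coincide.\<close>
    case True
    then consider "x = 0" | "x = 1" | "l = 1"
      using h2 l n by auto
    then have "L g x = B g x"
      by cases (auto simp: LB bernstein_pow_endpoints l simp del: One_nat_def)
    then show ?thesis using \<open>0 \<le> W\<close> by (simp add: LB)
  next
    case False
    have "h\<^sup>2 \<le> x * (1 - x)"
      unfolding h2 using x q by (intro mult_left_le power_le_one) auto
    also have "\<dots> = 1 / 4 - (x - 1 / 2)\<^sup>2" by (simp add: power2_eq_square algebra_simps)
    also have "\<dots> \<le> (1 / 2)\<^sup>2" by (simp add: power2_eq_square)
    finally have "h \<le> 1 / 2" by (rule power2_le_imp_le) simp
    with False \<open>0 \<le> h\<close> have h: "0 < h" "h \<le> 1 / 2" by auto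
    obtain F where F: "\<And>x. x \<in> {0..1} \<Longrightarrow> F x = g x" "F integrable_on {-1..2}"
      "\<And>x. x \<in> {-1<..<2} - {0, 1} \<Longrightarrow> isCont F x"
      "\<And>x t. \<lbrakk>0 \<le> x; x \<le> 1; 0 \<le> t; t \<le> h\<rbrakk> \<Longrightarrow> \<bar>F (x - t) - 2 * F x + F (x + t)\<bar> \<le> 3 / 2 * W"
      using zhuk_extension[OF h cont, of W] W by blast
    \<comment> \<open>Half the bound \<open>3/2 * W / h\<^sup>2\<close> on the second derivative, so
      that \<open>K * h\<^sup>2 = 3/4 * W\<close>.\<close>
    define K where "K = 3 / 2 * W / h\<^sup>2 / 2"
    have "finite {0, 1::real}" by simp
    from steklov_smoothing[OF this h F(2), of "3 / 2 * W"] F(3,4) obtain \<phi> where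
      \<phi>: "\<And>x. x \<in> {0..1} \<Longrightarrow> \<bar>\<phi> x - F x\<bar> \<le> 3 / 2 * W / 2"
      and convex: "convex_on {0..1} (\<lambda>x. K * x\<^sup>2 + \<phi> x)" "convex_on {0..1} (\<lambda>x. K * x\<^sup>2 - \<phi> x)"
      unfolding K_def by blast
    then have close: "\<And>t. t \<in> {0..1} \<Longrightarrow> \<bar>g t - \<phi> t\<bar> \<le> 3 / 4 * W"
      using F(1) \<phi> by (simp add: abs_minus_commute)
    have avg: "averaging_op L" "averaging_op B"
      unfolding LB by (intro averaging_op_bernstein_pow l n order_refl)+
    \<comment> \<open>Write the square as \<open>t - t * (1 - t)\<close>, a fixed function minus an
      eigenfunction. For \<open>k = 1\<close> the eigenvalue power vanishes because
      \<open>n \<ge> 1\<close>.\<close>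
    have sq: "bernstein_op k ^^ n = A \<Longrightarrow> averaging_op A \<Longrightarrow> k \<ge> 1 \<Longrightarrow>
        A (\<lambda>t. t\<^sup>2) x = x - (1 - 1 / real k) ^ n * (x * (1 - x))" for A k
    proof -
      assume A: "bernstein_op k ^^ n = A" "averaging_op A" "k \<ge> 1"
      have "(\<lambda>t::real. t\<^sup>2) = (\<lambda>t. (0 + 1 * t) - t * (1 - t))"
        by (auto simp: power2_eq_square algebra_simps)
      then have "A (\<lambda>t. t\<^sup>2) x = A (\<lambda>t. 0 + 1 * t) x - A (\<lambda>t. t * (1 - t)) x"
        by (simp only: averaging_op_diff[OF A(2)])
      then show ?thesis
        using bernstein_pow_affine[OF A(3), of n 0 1] bernstein_pow_parabola[OF A(3), of n] A(1)
        by simp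
    qed
    have Bsq: "B (\<lambda>t. t\<^sup>2) x - L (\<lambda>t. t\<^sup>2) x = h\<^sup>2"
      using sq[OF _ avg(1) l] sq[OF _ avg(2) order_refl] n by (simp add: LB h2 power_0_left)
    have "L (\<lambda>t. K * t\<^sup>2 + \<phi> t) x \<le> B (\<lambda>t. K * t\<^sup>2 + \<phi> t) x"
      "L (\<lambda>t. K * t\<^sup>2 - \<phi> t) x \<le> B (\<lambda>t. K * t\<^sup>2 - \<phi> t) x"
      unfolding LB by (intro bernstein_pow_convex_le l n x convex)+
    then have "\<bar>L \<phi> x - B \<phi> x\<bar> \<le> K * (B (\<lambda>t. t\<^sup>2) x - L (\<lambda>t. t\<^sup>2) x)"
      unfolding averaging_op_add[OF avg(1)] averaging_op_diff[OF avg(1)] averaging_op_cmult[OF avg(1)]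
        averaging_op_add[OF avg(2)] averaging_op_diff[OF avg(2)] averaging_op_cmult[OF avg(2)]
        right_diff_distrib by linarith
    also have "\<dots> = 3 / 4 * W" using h by (simp add: Bsq K_def)
    finally have "\<bar>L \<phi> x - B \<phi> x\<bar> \<le> 3 / 4 * W" .
    moreover have "\<bar>L (\<lambda>t. g t - \<phi> t) x\<bar> \<le> 3 / 4 * W" "\<bar>B (\<lambda>t. g t - \<phi> t) x\<bar> \<le> 3 / 4 * W"
      by (rule averaging_op_abs_le[OF avg(1) x close] averaging_op_abs_le[OF avg(2) x close],
          assumption)+
    then have "\<bar>L g x - L \<phi> x\<bar> \<le> 3 / 4 * W" "\<bar>B g x - B \<phi> x\<bar> \<le> 3 / 4 * W"
      by (simp_all only: averaging_op_diff[OF avg(1)] averaging_op_diff[OF avg(2)])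
    ultimately show ?thesis unfolding LB by linarith
  qed
qed

section \<open>Tensor products, one coordinate at a time\<close>

definition upd_coord :: "'d \<Rightarrow> real \<Rightarrow> real ^ 'd \<Rightarrow> real ^ 'd" where
  "upd_coord \<delta> t x = (\<chi> i. if i = \<delta> then t else x $ i)"

lemma upd_coord_nth: "upd_coord \<delta> t x $ i = (if i = \<delta> then t else x $ i)"
  by (simp add: upd_coord_def)

lemma upd_coord_commute:
  "\<epsilon> \<noteq> \<delta> \<Longrightarrow> upd_coord \<epsilon> \<tau> (upd_coord \<delta> t x) = upd_coord \<delta> t (upd_coord \<epsilon> \<tau> x)"
  by (auto simp: vec_eq_iff upd_coord_nth)

lemma upd_coord_in_unit_cube:
  "x \<in> unit_cube \<Longrightarrow> t \<in> {0..1} \<Longrightarrow> upd_coord \<delta> t x \<in> unit_cube"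
  by (auto simp: unit_cube_def upd_coord_nth)

lemma continuous_on_upd_coord:
  assumes "continuous_on S t" "continuous_on S g"
  shows "continuous_on S (\<lambda>y. upd_coord \<delta> (t y) (g y))"
  unfolding upd_coord_def
proof (rule continuous_on_vec_lambda)
  show "continuous_on S (\<lambda>y. if i = \<delta> then t y else g y $ i)" for i
    using assms by (cases "i = \<delta>") (auto intro: continuous_intros)
qed

lemma parametric_ext_upd_coord:
  "parametric_ext \<delta> A f x = A (\<lambda>t. f (upd_coord \<delta> t x)) (x $ \<delta>)"
  by (simp add: parametric_ext_def upd_coord_def)

text \<open>The extension is a finite sum of continuous weights in one coordinate times
  \<open>f\<close> with that coordinate frozen at a node.\<close>

lemma continuous_on_parametric_ext:
  assumes "averaging_op A" and f: "continuous_on unit_cube f"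
  shows "continuous_on unit_cube (parametric_ext \<delta> A f)"
proof (rule averaging_opE[OF assms(1)])
  fix z :: "nat \<Rightarrow> real" and w :: "nat \<Rightarrow> real \<Rightarrow> real" and N :: nat
  assume z: "\<And>j. z j \<in> {0..1}" and w: "\<And>j. continuous_on {0..1} (w j)"
    and A: "\<And>g x. A g x = (\<Sum>j\<le>N. w j x * g (z j))"
  have "continuous_on unit_cube (\<lambda>x. w j (x $ \<delta>))" for j
    by (rule continuous_on_compose2[OF w]) (auto simp: unit_cube_def intro!: continuous_intros)
  moreover have "continuous_on unit_cube (\<lambda>x. f (upd_coord \<delta> (z j) x))" for j
    by (rule continuous_on_compose2[OF f])
      (auto intro!: continuous_on_upd_coord continuous_intros upd_coord_in_unit_cube z[simplified])
  ultimately show ?thesis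
    unfolding parametric_ext_upd_coord A by (intro continuous_intros)
qed

text \<open>The fold of \<open>tensor_op\<close> over an arbitrary list of coordinates, to allow
  induction on the list.\<close>

definition tensor_list ::
    "('d \<Rightarrow> (real \<Rightarrow> real) \<Rightarrow> real \<Rightarrow> real) \<Rightarrow> 'd list \<Rightarrow> (real ^ 'd \<Rightarrow> real) \<Rightarrow> real ^ 'd \<Rightarrow> real" where
  "tensor_list A ds = foldr (\<lambda>\<delta> F. parametric_ext \<delta> (A \<delta>) \<circ> F) ds id"

lemma tensor_list_Nil: "tensor_list A [] f x = f x"
  by (simp add: tensor_list_def)

lemma tensor_list_Cons:
  "tensor_list A (\<delta> # ds) f = parametric_ext \<delta> (A \<delta>) (tensor_list A ds f)"
  by (simp add: tensor_list_def)

lemma continuous_on_tensor_list: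
  assumes "\<And>\<delta>. averaging_op (A \<delta>)" "continuous_on unit_cube f"
  shows "continuous_on unit_cube (tensor_list A ds f)"
proof (induction ds)
  case Nil
  then show ?case using assms(2) by (simp add: tensor_list_def)
next
  case (Cons \<delta> ds)
  then show ?case unfolding tensor_list_Cons by (rule continuous_on_parametric_ext[OF assms(1)])
qed

text \<open>Operators in coordinates other than \<open>\<delta>\<close> commute with substitution in
  \<open>\<delta>\<close>. By linearity they average the second difference, which preserves a
  uniform bound.\<close>

lemma tensor_list_second_difference:
  assumes A: "\<And>\<delta>. averaging_op (A \<delta>)" and "\<delta> \<notin> set ds" and "x \<in> unit_cube"
    and W: "\<And>y. y \<in> unit_cube \<Longrightarrow>
      \<bar>f (upd_coord \<delta> p y) - 2 * f (upd_coord \<delta> q y) + f (upd_coord \<delta> r y)\<bar> \<le> W"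
  shows "\<bar>tensor_list A ds f (upd_coord \<delta> p x) - 2 * tensor_list A ds f (upd_coord \<delta> q x)
    + tensor_list A ds f (upd_coord \<delta> r x)\<bar> \<le> W"
  using assms(2,3)
proof (induction ds arbitrary: x)
  case Nil
  then show ?case using W by (simp add: tensor_list_Nil)
next
  case (Cons \<epsilon> ds)
  then have "\<epsilon> \<noteq> \<delta>" "\<delta> \<notin> set ds" by auto
  define u where "u t \<tau> = tensor_list A ds f (upd_coord \<delta> t (upd_coord \<epsilon> \<tau> x))" for t \<tau>
  have x: "x $ \<epsilon> \<in> {0..1}" using Cons.prems by (auto simp: unit_cube_def)
  have "\<bar>A \<epsilon> (\<lambda>\<tau>. (u p \<tau> - 2 * u q \<tau>) + u r \<tau>) (x $ \<epsilon>)\<bar> \<le> W"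
  proof (rule averaging_op_abs_le[OF A x])
    fix \<tau> :: real assume "\<tau> \<in> {0..1}"
    then show "\<bar>(u p \<tau> - 2 * u q \<tau>) + u r \<tau>\<bar> \<le> W"
      unfolding u_def using Cons.IH \<open>\<delta> \<notin> set ds\<close> upd_coord_in_unit_cube Cons.prems(2) by blast
  qed
  moreover have "tensor_list A (\<epsilon> # ds) f (upd_coord \<delta> t x) = A \<epsilon> (u t) (x $ \<epsilon>)" for t
    using \<open>\<epsilon> \<noteq> \<delta>\<close> unfolding u_def
    by (simp add: tensor_list_Cons parametric_ext_upd_coord upd_coord_nth upd_coord_commute)
  ultimately show ?case
    by (simp add: averaging_op_add[OF A] averaging_op_diff[OF A] averaging_op_cmult[OF A])
qed

text \<open>Telescoping: the operators are exchanged one coordinate at a time; the coordinates already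
  exchanged average the error, and averaging in the others does not increase second differences
  in the current one.\<close>

lemma tensor_list_diff_le:
  fixes h \<Omega> :: "'d::finite \<Rightarrow> real \<Rightarrow> real"
  assumes A: "\<And>\<delta>. averaging_op (A \<delta>)" and C: "\<And>\<delta>. averaging_op (C \<delta>)"
    and AC: "\<And>\<delta> g t W. \<lbrakk>continuous_on {0..1} g; t \<in> {0..1};
        \<And>s \<eta>. \<lbrakk>0 \<le> \<eta>; \<eta> \<le> h \<delta> t; 0 \<le> s - \<eta>; s + \<eta> \<le> 1\<rbrakk>
          \<Longrightarrow> \<bar>g (s - \<eta>) - 2 * g s + g (s + \<eta>)\<bar> \<le> W\<rbrakk>
      \<Longrightarrow> \<bar>A \<delta> g t - C \<delta> g t\<bar> \<le> c * W"
    and f: "continuous_on unit_cube f"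
    and \<Omega>: "\<And>\<delta> r y s \<eta>. \<lbrakk>y \<in> unit_cube; 0 \<le> \<eta>; \<eta> \<le> r; 0 \<le> s - \<eta>; s + \<eta> \<le> 1\<rbrakk>
      \<Longrightarrow> \<bar>f (upd_coord \<delta> (s - \<eta>) y) - 2 * f (upd_coord \<delta> s y) + f (upd_coord \<delta> (s + \<eta>) y)\<bar> \<le> \<Omega> \<delta> r"
    and "distinct ds" and "x \<in> unit_cube"
  shows "\<bar>tensor_list A ds f x - tensor_list C ds f x\<bar> \<le> c * (\<Sum>\<delta>\<in>set ds. \<Omega> \<delta> (h \<delta> (x $ \<delta>)))"
  using assms(6,7)
proof (induction ds arbitrary: x)
  case Nil
  then show ?case by (simp add: tensor_list_Nil)
next
  case (Cons \<delta> ds)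
  then have ds: "\<delta> \<notin> set ds" "distinct ds" by auto
  \<comment> \<open>The error splits as \<open>A (u - v) + (A v - C v)\<close> in coordinate
    \<open>\<delta>\<close>: the induction hypothesis bounds the first term, the univariate estimate
    for the section \<open>v\<close> the second.\<close>
  define u where "u t = tensor_list A ds f (upd_coord \<delta> t x)" for t
  define v where "v t = tensor_list C ds f (upd_coord \<delta> t x)" for t
  let ?E = "c * (\<Sum>\<delta>\<in>set ds. \<Omega> \<delta> (h \<delta> (x $ \<delta>)))"
  have x: "x $ \<delta> \<in> {0..1}" using Cons.prems by (auto simp: unit_cube_def)
  have "\<bar>A \<delta> (\<lambda>t. u t - v t) (x $ \<delta>)\<bar> \<le> ?E"
  proof (rule averaging_op_abs_le[OF A x])
    fix t :: real assume "t \<in> {0..1}"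
    then have "\<bar>u t - v t\<bar> \<le> c * (\<Sum>\<epsilon>\<in>set ds. \<Omega> \<epsilon> (h \<epsilon> (upd_coord \<delta> t x $ \<epsilon>)))"
      unfolding u_def v_def by (intro Cons.IH ds upd_coord_in_unit_cube Cons.prems)
    \<comment> \<open>Since \<open>\<delta>\<close> is not in \<open>ds\<close>, the bound does not
      depend on \<open>t\<close> and survives averaging in \<open>t\<close>.\<close>
    also have "(\<Sum>\<epsilon>\<in>set ds. \<Omega> \<epsilon> (h \<epsilon> (upd_coord \<delta> t x $ \<epsilon>))) = (\<Sum>\<epsilon>\<in>set ds. \<Omega> \<epsilon> (h \<epsilon> (x $ \<epsilon>)))"
      using ds(1) by (intro sum.cong) (auto simp: upd_coord_nth)
    finally show "\<bar>u t - v t\<bar> \<le> ?E" .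
  qed
  then have "\<bar>A \<delta> u (x $ \<delta>) - A \<delta> v (x $ \<delta>)\<bar> \<le> ?E" by (simp only: averaging_op_diff[OF A])
  moreover have "\<bar>A \<delta> v (x $ \<delta>) - C \<delta> v (x $ \<delta>)\<bar> \<le> c * \<Omega> \<delta> (h \<delta> (x $ \<delta>))"
  proof (rule AC[OF _ x])
    show "continuous_on {0..1} v"
      unfolding v_def
      by (rule continuous_on_compose2[OF continuous_on_tensor_list[OF C f]])
        (use Cons.prems in \<open>auto intro!: continuous_on_upd_coord continuous_intros upd_coord_in_unit_cube\<close>)
    show "\<bar>v (s - \<eta>) - 2 * v s + v (s + \<eta>)\<bar> \<le> \<Omega> \<delta> (h \<delta> (x $ \<delta>))"
      if "0 \<le> \<eta>" "\<eta> \<le> h \<delta> (x $ \<delta>)" "0 \<le> s - \<eta>" "s + \<eta> \<le> 1" for s \<eta>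
      unfolding v_def
      by (rule tensor_list_second_difference[OF C ds(1) Cons.prems(2)]) (rule \<Omega>[OF _ that])
  qed
  moreover have "tensor_list A (\<delta> # ds) f x = A \<delta> u (x $ \<delta>)"
    "tensor_list C (\<delta> # ds) f x = C \<delta> v (x $ \<delta>)"
    unfolding u_def v_def by (simp_all only: tensor_list_Cons parametric_ext_upd_coord)
  moreover have "c * (\<Sum>\<delta>\<in>set (\<delta> # ds). \<Omega> \<delta> (h \<delta> (x $ \<delta>))) = c * \<Omega> \<delta> (h \<delta> (x $ \<delta>)) + ?E"
    using ds by (simp add: distrib_left)
  ultimately show ?case by linarith
qed

section \<open>Partial moduli and the multivariate estimate\<close>

text \<open>A continuous function on the compact cube is bounded, so the set defining the modulus is
  bounded above and its real supremum is an upper bound.\<close>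

lemma second_difference_le_partial_omega2:
  fixes f :: "real ^ 'd::finite \<Rightarrow> real"
  assumes f: "continuous_on unit_cube f" and y: "y \<in> unit_cube"
    and s: "0 \<le> \<eta>" "\<eta> \<le> r" "0 \<le> s - \<eta>" "s + \<eta> \<le> 1"
  shows "\<bar>f (upd_coord \<delta> (s - \<eta>) y) - 2 * f (upd_coord \<delta> s y) + f (upd_coord \<delta> (s + \<eta>) y)\<bar>
    \<le> partial_omega2 f \<delta> r"
proof -
  have cube: "(unit_cube :: (real ^ 'd) set) = cbox 0 1"
    by (auto simp: unit_cube_def mem_box_cart)
  have "compact (unit_cube :: (real ^ 'd) set)" unfolding cube by (rule compact_cbox)
  then have "bounded (f ` unit_cube)"
    using compact_continuous_image[OF f] compact_imp_bounded by blast
  then obtain K where K: "\<And>z. z \<in> unit_cube \<Longrightarrow> \<bar>f z\<bar> \<le> K"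
    by (auto simp: bounded_iff)
  let ?S = "{\<bar>f (s - \<eta> *\<^sub>R axis \<delta> 1) - 2 * f s + f (s + \<eta> *\<^sub>R axis \<delta> 1)\<bar> | s \<eta>.
       s \<in> unit_cube \<and> \<bar>\<eta>\<bar> \<le> r \<and>
       s - \<eta> *\<^sub>R axis \<delta> 1 \<in> unit_cube \<and> s + \<eta> *\<^sub>R axis \<delta> 1 \<in> unit_cube}"
  have "bdd_above ?S"
  proof (rule bdd_aboveI)
    fix b assume "b \<in> ?S"
    then obtain s \<eta> where b: "b = \<bar>f (s - \<eta> *\<^sub>R axis \<delta> 1) - 2 * f s + f (s + \<eta> *\<^sub>R axis \<delta> 1)\<bar>"
      and "s \<in> unit_cube" "s - \<eta> *\<^sub>R axis \<delta> 1 \<in> unit_cube" "s + \<eta> *\<^sub>R axis \<delta> 1 \<in> unit_cube"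
      by auto
    from this(2-4)[THEN K] show "b \<le> 4 * K" unfolding b by linarith
  qed
  moreover have "upd_coord \<delta> (s - \<eta>) y = upd_coord \<delta> s y - \<eta> *\<^sub>R axis \<delta> 1"
    "upd_coord \<delta> (s + \<eta>) y = upd_coord \<delta> s y + \<eta> *\<^sub>R axis \<delta> 1"
    by (auto simp: vec_eq_iff upd_coord_nth axis_def)
  moreover have "upd_coord \<delta> s y \<in> unit_cube" "upd_coord \<delta> (s - \<eta>) y \<in> unit_cube"
    "upd_coord \<delta> (s + \<eta>) y \<in> unit_cube"
    using s by (auto intro!: upd_coord_in_unit_cube y)
  ultimately show ?thesis
    unfolding partial_omega2_def using s
    by (intro cSup_upper CollectI exI[of _ "upd_coord \<delta> s y"] exI[of _ \<eta>]) auto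
qed

theorem mainTheorem1:
  fixes l n :: "'d::{finite, linorder} \<Rightarrow> nat"
    and f :: "real ^ 'd::{finite, linorder} \<Rightarrow> real"
    and x :: "real ^ 'd::{finite, linorder}"
  assumes "\<And>\<delta>. l \<delta> \<ge> 1"
    and "\<And>\<delta>. n \<delta> \<ge> 1"
    and "continuous_on unit_cube f"
    and "x \<in> unit_cube"
  shows "\<bar>tensor_op (\<lambda>\<delta>. bernstein_op (l \<delta>) ^^ n \<delta>) f x
          - tensor_op (\<lambda>\<delta>. bernstein_op 1 ^^ n \<delta>) f x\<bar>
    \<le> 9 / 4 * (\<Sum>\<delta>\<in>UNIV. partial_omega2 f \<delta>
          (sqrt (x $ \<delta> * (1 - x $ \<delta>) * (1 - 1 / real (l \<delta>)) ^ n \<delta>)))"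
proof -
  define A where "A \<delta> = bernstein_op (l \<delta>) ^^ n \<delta>" for \<delta>
  define C where "C \<delta> = bernstein_op 1 ^^ n \<delta>" for \<delta>
  define h where "h \<delta> t = sqrt (t * (1 - t) * (1 - 1 / real (l \<delta>)) ^ n \<delta>)" for \<delta> t
  let ?ds = "sorted_list_of_set (UNIV :: 'd set)"
  have "\<bar>tensor_list A ?ds f x - tensor_list C ?ds f x\<bar>
      \<le> 9 / 4 * (\<Sum>\<delta>\<in>set ?ds. partial_omega2 f \<delta> (h \<delta> (x $ \<delta>)))"
  proof (rule tensor_list_diff_le[where h = h and \<Omega> = "partial_omega2 f"])
    show "averaging_op (A \<delta>)" "averaging_op (C \<delta>)" for \<delta>
      unfolding A_def C_def by (intro averaging_op_bernstein_pow assms(1,2) order_refl)+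
    show "\<bar>A \<delta> g t - C \<delta> g t\<bar> \<le> 9 / 4 * W"
      if "continuous_on {0..1} g" "t \<in> {0..1}"
        "\<And>s \<eta>. \<lbrakk>0 \<le> \<eta>; \<eta> \<le> h \<delta> t; 0 \<le> s - \<eta>; s + \<eta> \<le> 1\<rbrakk>
          \<Longrightarrow> \<bar>g (s - \<eta>) - 2 * g s + g (s + \<eta>)\<bar> \<le> W" for \<delta> g t W
      unfolding A_def C_def
      by (rule bernstein_pow_diff_le[OF assms(1,2) that(1,2) h_def]) (rule that(3))
  qed (use second_difference_le_partial_omega2 assms(3,4) in auto)
  then show ?thesis
    unfolding A_def C_def h_def tensor_list_def tensor_op_def by simp
qed

end
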